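(* Let $n\ge 1$, let $\mu$ be a partition of length at most $n$ and let $r\ge 1$ be an integer. Then $$\overline{p}_r\,\mathrm{so}_{\mu}=\sum_{\eta/\mu\in \mathrm{BS}(r)}(-1)^{\mathrm{ht}(\eta/\mu)}\,\mathrm{so}_{\eta}+\sum_{\mu/\xi\in \mathrm{BS}(r)}(-1)^{\mathrm{ht}(\mu/\xi)}\,\mathrm{so}_{\xi}+\sum_{q=m_o(\mu)+1}^{n}(-1)^{p(q)-q+1}\,\mathrm{so}_{\mu_o^{(q)}},$$ where the first sum is over partitions $\eta\supseteq\mu$ such that $\eta/\mu$ is a border strip with $r$ boxes, and the second is over partitions $\xi\subseteq\mu$ such that $\mu/\xi$ is a border strip with $r$ boxes.
   Context: Let $X=(x_1,\dots,x_n)$ be commuting indeterminates (with formal square roots $x_i^{1/2}$ adjoined) and $\bar x_i=x_i^{-1}$. Put $\overline{p}_r=\sum_{i=1}^n(x_i^r+\bar x_i^{\,r})$. Partitions are identified with their Young diagrams. A border strip is a (nonempty) skew diagram that is connected (any two boxes are joined by a sequence of boxes, consecutive ones sharing a side) and contains no $2\times2$ block of boxes. Its height $\mathrm{ht}$ is one less than its number of nonempty rows. $\mathrm{BS}(r)$ denotes the border strips with exactly $r$ boxes. For a partition $\lambda=(\lambda_1,\dots,\lambda_n)$ of length at most $n$ (padded with zeros), the odd orthogonal character is $$\mathrm{so}_\lambda=\mathrm{so}_\lambda(X)=\frac{\det_{1\le i,j\le n}\bigl(x_i^{\lambda_j+n-j+1/2}-\bar x_i^{\lambda_j+n-j+1/2}\bigr)}{\det_{1\le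 i,j\le n}\bigl(x_i^{n-j+1/2}-\bar x_i^{n-j+1/2}\bigr)}.$$ Partitions of length greater than $n$ contribute nothing to the sums ($\mathrm{so}_\lambda$ is taken to be $0$ for them). Let $\delta=(n-\tfrac12,n-\tfrac32,\dots,\tfrac12)$. Define $m_o(\mu)=0$ if $\mu_i+\delta_i<r$ for all $i\in\{1,\dots,n\}$, and $m_o(\mu)=\max\{i\mid \mu_i+\delta_i\ge r\}$ otherwise. For $q$ with $\mu_q+\delta_q-r<0$ (i.e. $q>m_o(\mu)$), let $\Delta_q$ be the rearrangement in descending order of $$(\mu_1+\delta_1,\dots,\mu_{q-1}+\delta_{q-1},\,r-(\mu_q+\delta_q),\,\mu_{q+1}+\delta_{q+1},\dots,\mu_n+\delta_n),$$ and set $\mu_o^{(q)}=\Delta_q-\delta$. If $r-(\mu_q+\delta_q)=\mu_j+\delta_j$ for some $j\ne q$, then $\mu_o^{(q)}$ is not a partition and one sets $\mathrm{so}_{\mu_o^{(q)}}=0$ (the corresponding term of the sum is $0$). Otherwise $\mu_o^{(q)}$ is a partition and $p(q)$ denotes the index (position) of the entry $r-(\mu_q+\delta_q)$ in $\Delta_q$. *)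

theory Defs
  imports
    "HOL-Library.Poly_Mapping"
    "HOL-Computational_Algebra.Fraction_Field"
    "Jordan_Normal_Form.Determinant"
begin

section \<open>Rational functions in the square roots of the indeterminates\<close>

text \<open>
  The polynomial ring has indeterminates \<open>y\<^sub>1, y\<^sub>2, \<dots>\<close>, where \<open>y\<^sub>i\<close> plays the role of the
  formal square root of \<open>x\<^sub>i = indet i\<close>; we work in its field of fractions. For given \<open>n\<close>, only
  \<open>y\<^sub>1, \<dots>, y\<^sub>n\<close> are used.
\<close>

type_synonym 'a ratfun = "((nat \<Rightarrow>\<^sub>0 nat) \<Rightarrow>\<^sub>0 'a) fract"

definition sqrt_x :: "nat \<Rightarrow> 'a::idom ratfun" where
  "sqrt_x i = Fract (Poly_Mapping.single (Poly_Mapping.single i 1) 1) 1"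

definition indet :: "nat \<Rightarrow> 'a::idom ratfun" where
  "indet i = sqrt_x i ^ 2"

definition pbar :: "nat \<Rightarrow> nat \<Rightarrow> 'a::idom ratfun" where
  "pbar n r = (\<Sum>i=1..n. indet i ^ r + inverse (indet i) ^ r)"

section \<open>Partitions and border strips\<close>

text \<open>
  A partition is given by its sequence of parts \<open>\<lambda> 1 \<ge> \<lambda> 2 \<ge> \<dots>\<close>, padded with zeros. The
  index \<open>0\<close> is not used; fixing \<open>\<lambda> 0 = 0\<close> makes the representation unique.
\<close>

definition is_partition :: "(nat \<Rightarrow> nat) \<Rightarrow> bool" where
  "is_partition l \<longleftrightarrow> l 0 = 0 \<and> (\<forall>i\<ge>1. l (Suc i) \<le> l i) \<and> finite {i. l i \<noteq> 0}"

definition length_at_most :: "nat \<Rightarrow> (nat \<Rightarrow> nat) \<Rightarrow> bool" where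
  "length_at_most n l \<longleftrightarrow> (\<forall>i>n. l i = 0)"

definition diagram :: "(nat \<Rightarrow> nat) \<Rightarrow> (nat \<times> nat) set" where
  "diagram l = {(i, j). 1 \<le> i \<and> 1 \<le> j \<and> j \<le> l i}"

definition skew :: "(nat \<Rightarrow> nat) \<Rightarrow> (nat \<Rightarrow> nat) \<Rightarrow> (nat \<times> nat) set" where
  "skew l m = diagram l - diagram m"

fun share_side :: "nat \<times> nat \<Rightarrow> nat \<times> nat \<Rightarrow> bool" where
  "share_side (i, j) (i', j') \<longleftrightarrow>
     (i = i' \<and> (j' = Suc j \<or> j = Suc j')) \<or> (j = j' \<and> (i' = Suc i \<or> i = Suc i'))"

definition connected_boxes :: "(nat \<times> nat) set \<Rightarrow> bool" where
  "connected_boxes S \<longleftrightarrow>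
     (\<forall>b\<in>S. \<forall>c\<in>S. (b, c) \<in> {(u, v). u \<in> S \<and> v \<in> S \<and> share_side u v}\<^sup>*)"

definition has_2x2_block :: "(nat \<times> nat) set \<Rightarrow> bool" where
  "has_2x2_block S \<longleftrightarrow> (\<exists>i j. {(i, j), (i, Suc j), (Suc i, j), (Suc i, Suc j)} \<subseteq> S)"

text \<open>\<open>border_strip r l m\<close> says that \<open>m\<close> is contained in \<open>l\<close> and \<open>l/m\<close> lies in \<open>BS(r)\<close>.\<close>

definition border_strip :: "nat \<Rightarrow> (nat \<Rightarrow> nat) \<Rightarrow> (nat \<Rightarrow> nat) \<Rightarrow> bool" where
  "border_strip r l m \<longleftrightarrow>
     diagram m \<subseteq> diagram l \<and> skew l m \<noteq> {} \<and> connected_boxes (skew l m) \<and>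
     \<not> has_2x2_block (skew l m) \<and> card (skew l m) = r"

definition height :: "(nat \<Rightarrow> nat) \<Rightarrow> (nat \<Rightarrow> nat) \<Rightarrow> nat" where
  "height l m = card (fst ` skew l m) - 1"

section \<open>Odd orthogonal characters\<close>

text \<open>
  Matrices are indexed from \<open>0\<close>, whence the shift by \<open>Suc\<close>. The power
  \<open>x\<^sub>i\<close> to the \<open>a + 1/2\<close> is \<open>sqrt_x i ^ (2 * a + 1)\<close>.
\<close>

definition so_det :: "nat \<Rightarrow> (nat \<Rightarrow> nat) \<Rightarrow> 'a::idom ratfun" where
  "so_det n l = det (mat n n (\<lambda>(i, j).
     sqrt_x (Suc i) ^ (2 * (l (Suc j) + (n - Suc j)) + 1)
     - inverse (sqrt_x (Suc i)) ^ (2 * (l (Suc j) + (n - Suc j)) + 1)))"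

definition so :: "nat \<Rightarrow> (nat \<Rightarrow> nat) \<Rightarrow> 'a::idom ratfun" where
  "so n l = (if length_at_most n l then so_det n l / so_det n (\<lambda>_. 0) else 0)"

section \<open>The reflected partitions\<close>

definition delta :: "nat \<Rightarrow> nat \<Rightarrow> rat" where
  "delta n i = of_nat n - of_nat i + 1/2"

definition shifted :: "nat \<Rightarrow> (nat \<Rightarrow> nat) \<Rightarrow> nat \<Rightarrow> rat" where
  "shifted n m i = of_nat (m i) + delta n i"

definition m_o :: "nat \<Rightarrow> nat \<Rightarrow> (nat \<Rightarrow> nat) \<Rightarrow> nat" where
  "m_o n r m =
     (if \<forall>i\<in>{1..n}. shifted n m i < of_nat r then 0
      else Max {i \<in> {1..n}. shifted n m i \<ge> of_nat r})"

definition reflected_entry :: "nat \<Rightarrow> nat \<Rightarrow> (nat \<Rightarrow> nat) \<Rightarrow> nat \<Rightarrow> rat" where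
  "reflected_entry n r m q = of_nat r - shifted n m q"

definition Delta :: "nat \<Rightarrow> nat \<Rightarrow> (nat \<Rightarrow> nat) \<Rightarrow> nat \<Rightarrow> rat list" where
  "Delta n r m q =
     rev (sort (map ((shifted n m)(q := reflected_entry n r m q)) [1..<Suc n]))"

text \<open>
  When the entries of \<open>Delta n r m q\<close> are distinct and positive, the differences below are
  natural numbers and \<open>nat \<lfloor>_\<rfloor>\<close> is merely the conversion from type \<open>rat\<close>.
\<close>

definition mu_o :: "nat \<Rightarrow> nat \<Rightarrow> (nat \<Rightarrow> nat) \<Rightarrow> nat \<Rightarrow> nat \<Rightarrow> nat" where
  "mu_o n r m q i =
     (if i \<in> {1..n} then nat \<lfloor>Delta n r m q ! (i - 1) - delta n i\<rfloor> else 0)"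

definition p_index :: "nat \<Rightarrow> nat \<Rightarrow> (nat \<Rightarrow> nat) \<Rightarrow> nat \<Rightarrow> nat" where
  "p_index n r m q =
     (THE p. p \<in> {1..n} \<and> Delta n r m q ! (p - 1) = reflected_entry n r m q)"

definition so_mu_o :: "nat \<Rightarrow> nat \<Rightarrow> (nat \<Rightarrow> nat) \<Rightarrow> nat \<Rightarrow> 'a::idom ratfun" where
  "so_mu_o n r m q =
     (if \<exists>j\<in>{1..n} - {q}. reflected_entry n r m q = shifted n m j then 0
      else so n (mu_o n r m q))"

end

theory Submission imports Defs begin

text \<open>
  Write \<open>a\<^sub>c\<close> for the determinant with entries \<open>x\<^sub>i\<close> to the \<open>c\<^sub>j + 1/2\<close> minus \<open>x\<^sub>i\<close> to the
  \<open>- (c\<^sub>j + 1/2)\<close>, for an arbitrary sequence \<open>c\<close> of integers. Up to the common denominator,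
  the character of \<open>\<mu>\<close> is \<open>a\<^sub>c\<close> for the strictly decreasing sequence
  \<open>c\<^sub>j = \<mu>\<^sub>j + n - j\<close> of beta numbers. The denominator is the same for all characters, so the
  theorem is an identity between numerators, and it does not matter whether the denominator vanishes.

  Multiplying a column by \<open>x\<^sub>i\<^sup>r + x\<^sub>i\<^sup>-\<^sup>r\<close> adds up the columns with exponent raised and
  lowered by \<open>r\<close>. Expanding the determinant over permutations, the power sum distributes over the columns
  (lemma \<open>power_sum_times_alternant\<close>): \<open>p\<^sub>r a\<^sub>c\<close> is the sum over \<open>q\<close> of the determinants obtained
  by replacing \<open>c\<^sub>q\<close> by \<open>c\<^sub>q + r\<close> and by \<open>c\<^sub>q - r\<close>. Each of these vanishes if the new entry
  is also another entry of the sequence. Otherwise, if the new entry \<open>v\<close> is nonnegative, moving it from position \<open>q\<close>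
  to the position \<open>p\<close> where it belongs costs the sign \<open>(-1)\<^sup>p\<^sup>+\<^sup>q\<close> and yields the beta numbers of
  another partition (lemma \<open>sum_alternant_moves\<close>).

  For \<open>v = c\<^sub>q + r\<close> these partitions are those that arise by adding a border strip of size \<open>r\<close>
  in the rows \<open>p, \<dots>, q\<close>; for \<open>v = c\<^sub>q - r \<ge> 0\<close> they are those that arise by removing one in the rows
  \<open>q, \<dots>, p\<close>. Indeed \<open>l/m\<close> is a border strip exactly if the rows that it meets form an interval and each of
  them but the first ends one box to the right of the preceding row of \<open>m\<close>
  (lemma \<open>border_strip_iff_strip_rows\<close>), which says that the beta numbers in these rows are shifted by one
  position. This gives the first two sums.

  There remain the \<open>q\<close> with \<open>c\<^sub>q < r\<close>, which are those beyond \<open>m_o\<close>. As \<open>a\<^sub>c\<close> changes sign when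
  \<open>c\<^sub>q + 1/2\<close> is negated, the entry \<open>c\<^sub>q - r\<close> may be replaced by the nonnegative \<open>r - c\<^sub>q - 1\<close>;
  sorting again yields the third sum term by term (lemma \<open>reflected_term\<close>).
\<close>

section \<open>Alternants of odd orthogonal type\<close>

text \<open>
  The exponents are arbitrary integers, so that they may be repeated, unsorted or negative. The odd integer
  \<open>2 * c j + 1\<close> belongs to the half-integer \<open>c j + 1/2\<close>, since \<open>y i\<close> is the square root of \<open>x\<^sub>i\<close>.
\<close>

definition alternant :: "(nat \<Rightarrow> 'k::field) \<Rightarrow> nat \<Rightarrow> (nat \<Rightarrow> int) \<Rightarrow> 'k" where
  "alternant y n c = det (mat n n (\<lambda>(i, j).
     y (Suc i) powi (2 * c (Suc j) + 1) - y (Suc i) powi - (2 * c (Suc j) + 1)))"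

lemma alternant_cong:
  assumes "\<And>i. i \<in> {1..n} \<Longrightarrow> c i = d i"
  shows "alternant y n c = alternant y n d"
  unfolding alternant_def
  by (intro arg_cong[of _ _ det] cong_mat) (use assms in auto)

lemma alternant_leibniz:
  "alternant y n c = (\<Sum>\<pi> | \<pi> permutes {0..<n}. signof \<pi> *
     (\<Prod>j<n. y (Suc (\<pi> j)) powi (2 * c (Suc j) + 1) - y (Suc (\<pi> j)) powi - (2 * c (Suc j) + 1)))"
proof -
  have "\<pi> j < n" if "\<pi> permutes {0..<n}" "j < n" for \<pi> j
    using permutes_in_image[OF that(1), of j] that(2) by simp
  then show ?thesis
    unfolding alternant_def
    by (subst det_col[of _ n]) (auto intro!: sum.cong prod.cong)
qed

text \<open>
  In the term of a permutation \<open>\<pi>\<close>, the power sum may be summed as \<open>w (\<pi> q)\<close> over the columns \<open>q\<close>,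
  where \<open>w i = x\<^sub>i\<^sup>r + x\<^sub>i\<^sup>-\<^sup>r\<close>. Its summand for \<open>q\<close> then meets the factor of column \<open>q\<close>, which lies in row
  \<open>\<pi> q\<close>, and splits it into the factors with the exponent raised and lowered by \<open>r\<close>.
\<close>

lemma power_sum_times_alternant:
  fixes y :: "nat \<Rightarrow> 'k::field"
  assumes y: "\<And>i. y i \<noteq> 0"
  shows "(\<Sum>i=1..n. (y i ^ 2) ^ r + inverse (y i ^ 2) ^ r) * alternant y n c =
    (\<Sum>q=1..n. alternant y n (c(q := c q + int r)) + alternant y n (c(q := c q - int r)))"
proof -
  define f where "f i k = y (Suc i) powi (2 * k + 1) - y (Suc i) powi - (2 * k + 1)" for i k
  define w where "w i = (y (Suc i) ^ 2) ^ r + inverse (y (Suc i) ^ 2) ^ r" for i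
  have w: "w i = y (Suc i) powi (2 * int r) + y (Suc i) powi - (2 * int r)" for i
    unfolding w_def by (simp add: power_int_mult power_int_minus power_inverse)
  have fw: "f i k * w i = f i (k + int r) + f i (k - int r)" for i k
  proof -
    have "y (Suc i) powi a * y (Suc i) powi b = y (Suc i) powi (a + b)" for a b
      using y[of "Suc i"] by (simp add: power_int_add)
    then show ?thesis
      unfolding f_def w by (simp add: algebra_simps)
  qed
  have split: "(\<Prod>j<n. f (\<pi> j) (c (Suc j))) * w (\<pi> q) =
      (\<Prod>j<n. f (\<pi> j) ((c(Suc q := c (Suc q) + int r)) (Suc j))) +
      (\<Prod>j<n. f (\<pi> j) ((c(Suc q := c (Suc q) - int r)) (Suc j)))"
    if "q < n" for \<pi> q
  proof -
    define P where "P = (\<Prod>j\<in>{..<n} - {q}. f (\<pi> j) (c (Suc j)))"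
    have upd: "(\<Prod>j<n. f (\<pi> j) ((c(Suc q := v)) (Suc j))) = f (\<pi> q) v * P" for v
      unfolding P_def using that
      by (subst prod.remove[of _ q]) (auto intro!: arg_cong2[of _ _ _ _ "(*)"] prod.cong)
    have "(\<Prod>j<n. f (\<pi> j) (c (Suc j))) * w (\<pi> q) = f (\<pi> q) (c (Suc q)) * w (\<pi> q) * P"
      unfolding P_def using that by (simp add: prod.remove[of "{..<n}" q])
    then show ?thesis
      unfolding upd fw by (simp only: distrib_right)
  qed
  have w_perm: "(\<Sum>i<n. w i) = (\<Sum>q<n. w (\<pi> q))" if "\<pi> permutes {0..<n}" for \<pi>
    using sum.permute[OF that, of w] by (simp add: atLeast0LessThan comp_def)
  have "(\<Sum>i=1..n. (y i ^ 2) ^ r + inverse (y i ^ 2) ^ r) = (\<Sum>i<n. w i)"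
    by (simp add: w_def sum.atLeast1_atMost_eq)
  then have "(\<Sum>i=1..n. (y i ^ 2) ^ r + inverse (y i ^ 2) ^ r) * alternant y n c =
      (\<Sum>\<pi> | \<pi> permutes {0..<n}. signof \<pi> * ((\<Prod>j<n. f (\<pi> j) (c (Suc j))) * (\<Sum>i<n. w i)))"
    by (simp add: alternant_leibniz f_def sum_distrib_left mult_ac)
  also have "\<dots> = (\<Sum>\<pi> | \<pi> permutes {0..<n}. \<Sum>q<n.
      signof \<pi> * ((\<Prod>j<n. f (\<pi> j) (c (Suc j))) * w (\<pi> q)))"
    by (intro sum.cong) (auto simp: w_perm sum_distrib_left)
  also have "\<dots> = (\<Sum>q<n. \<Sum>\<pi> | \<pi> permutes {0..<n}.
      signof \<pi> * ((\<Prod>j<n. f (\<pi> j) (c (Suc j))) * w (\<pi> q)))"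
    by (rule sum.swap)
  also have "\<dots> = (\<Sum>q<n. alternant y n (c(Suc q := c (Suc q) + int r)) +
      alternant y n (c(Suc q := c (Suc q) - int r)))"
    unfolding alternant_leibniz f_def[symmetric]
    by (intro sum.cong refl) (simp add: split distrib_left sum.distrib del: fun_upd_apply)
  finally show ?thesis
    by (simp add: sum.atLeast1_atMost_eq)
qed

lemma alternant_repeated:
  assumes "i \<in> {1..n}" "j \<in> {1..n}" "i \<noteq> j" "c i = c j"
  shows "alternant y n c = 0"
proof -
  obtain i' j' where "i = Suc i'" "j = Suc j'"
    using assms(1,2) by (metis atLeastAtMost_iff not0_implies_Suc not_one_le_zero)
  then show ?thesis
    unfolding alternant_def using assms
    by (intro det_identical_columns[of _ n i' j']) (auto intro!: eq_vecI)
qed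

lemma alternant_swap_adjacent:
  assumes "1 \<le> p" "Suc p \<le> n"
  shows "alternant y n (c(p := c (Suc p), Suc p := c p)) = - alternant y n c"
proof -
  define A where "A = mat n n (\<lambda>(i, j).
     y (Suc i) powi (2 * c (Suc j) + 1) - y (Suc i) powi - (2 * c (Suc j) + 1))"
  obtain p' where p': "p = Suc p'"
    using assms(1) by (cases p) auto
  have "alternant y n (c(p := c (Suc p), Suc p := c p)) = det (swapcols p' (Suc p') A)"
    unfolding alternant_def
    by (intro arg_cong[of _ _ det] eq_matI) (use assms p' in \<open>auto simp: A_def\<close>)
  also have "\<dots> = - det A"
    using assms p' by (intro det_swapcols[of _ n]) (auto simp: A_def)
  finally show ?thesis
    by (simp add: alternant_def A_def)
qed

text \<open>
  The entries of a column change sign under \<open>k + 1/2 \<mapsto> - (k + 1/2)\<close>, which is \<open>k \<mapsto> - k - 1\<close> on the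
  integers \<open>k\<close> that index the exponents.
\<close>

lemma alternant_reflect:
  assumes "q \<in> {1..n}"
  shows "alternant y n (c(q := v)) = - alternant y n (c(q := - v - 1))"
proof -
  obtain q' where q': "q = Suc q'" "q' < n"
    using assms by (cases q) auto
  define f where "f i k = y (Suc i) powi (2 * k + 1) - y (Suc i) powi - (2 * k + 1)" for i k
  have odd: "2 * (- v - 1) + 1 = - (2 * v + 1)"
    by simp
  have neg: "f i v = - f i (- v - 1)" for i
    unfolding f_def odd minus_minus by (rule minus_diff_eq[symmetric])
  have upd: "(\<Prod>j<n. f (\<pi> j) ((c(q := u)) (Suc j))) =
      f (\<pi> q') u * (\<Prod>j\<in>{..<n} - {q'}. f (\<pi> j) (c (Suc j)))" for \<pi> u
    using q' by (subst prod.remove[of _ q']) (auto intro!: arg_cong2[of _ _ _ _ "(*)"] prod.cong)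
  have "(\<Prod>j<n. f (\<pi> j) ((c(q := v)) (Suc j))) =
      - (\<Prod>j<n. f (\<pi> j) ((c(q := - v - 1)) (Suc j)))" for \<pi>
    unfolding upd by (subst neg, rule mult_minus_left)
  then show ?thesis
    unfolding alternant_leibniz f_def[symmetric] by (simp add: sum_negf)
qed

text \<open>
  Entry \<open>q\<close> is taken out of the sequence and \<open>v\<close> is inserted so as to end up at position \<open>p\<close>; the entries between
  move by one place, to the right if \<open>p < q\<close> and to the left if \<open>q < p\<close>.
\<close>

definition relocate :: "(nat \<Rightarrow> int) \<Rightarrow> nat \<Rightarrow> nat \<Rightarrow> int \<Rightarrow> nat \<Rightarrow> int" where
  "relocate c q p v i =
     (if i = p then v else if p < i \<and> i \<le> q then c (i - 1)
      else if q \<le> i \<and> i < p then c (i + 1) else c i)"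

lemma relocate_self: "relocate c q q v = c(q := v)"
  by (auto simp: relocate_def fun_eq_iff)

text \<open>
  Raising the target position \<open>p\<close> by one swaps two adjacent columns, so \<open>(-1)\<^sup>p\<close> times the alternant does not
  depend on \<open>p\<close>; the case \<open>p = q\<close> is a plain update.
\<close>

lemma alternant_relocate:
  assumes "q \<in> {1..n}" "p \<in> {1..n}"
  shows "alternant y n (c(q := v)) = (-1) ^ (p + q) * alternant y n (relocate c q p v)"
proof -
  have step: "alternant y n (relocate c q (Suc p) v) = - alternant y n (relocate c q p v)"
    if "1 \<le> p" "Suc p \<le> n" for p
  proof -
    have "relocate c q (Suc p) v = (relocate c q p v)(p := relocate c q p v (Suc p), Suc p := relocate c q p v p)"
      by (auto simp: relocate_def fun_eq_iff)
    then show ?thesis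
      using alternant_swap_adjacent[OF that] by metis
  qed
  have shift: "(-1) ^ p * alternant y n (relocate c q p v) = - alternant y n (relocate c q 1 v)"
    if "1 \<le> p" "p \<le> n" for p
    using that by (induction p rule: dec_induct) (auto simp: step)
  have "(-1) ^ q * alternant y n (c(q := v)) = (-1) ^ p * alternant y n (relocate c q p v)"
    using shift[of p] shift[of q] assms by (simp add: relocate_self)
  then have "(-1) ^ q * ((-1) ^ q * alternant y n (c(q := v))) = (-1) ^ q * ((-1) ^ p * alternant y n (relocate c q p v))"
    by simp
  moreover have "(-1) ^ q * ((-1) ^ q * z) = z" for z :: 'a
    by (simp flip: mult.assoc power_add)
  ultimately show ?thesis
    by (simp add: power_add mult_ac)
qed

section \<open>Strictly decreasing sequences\<close>

definition decreasing_upto :: "nat \<Rightarrow> (nat \<Rightarrow> int) \<Rightarrow> bool" where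
  "decreasing_upto n c \<longleftrightarrow> (\<forall>i j. 1 \<le> i \<longrightarrow> i < j \<longrightarrow> j \<le> n \<longrightarrow> c j < c i)"

lemma decreasing_uptoD: "decreasing_upto n c \<Longrightarrow> 1 \<le> i \<Longrightarrow> i < j \<Longrightarrow> j \<le> n \<Longrightarrow> c j < c i"
  by (auto simp: decreasing_upto_def)

lemma decreasing_upto_inj:
  assumes "decreasing_upto n c" "i \<in> {1..n}" "j \<in> {1..n}" "c i = c j"
  shows "i = j"
  using assms decreasing_uptoD[OF assms(1), of i j] decreasing_uptoD[OF assms(1), of j i]
  by (cases i j rule: linorder_cases) auto

lemma sorted_map_decreasing:
  assumes "decreasing_upto n c"
  shows "sorted_wrt (<) (rev (map c [1..<Suc n]))"
  using assms by (auto simp: sorted_wrt_iff_nth_less rev_nth decreasing_upto_def simp del: upt_Suc)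

text \<open>
  A strictly decreasing sequence lists the set of its values in descending order.
\<close>

lemma decreasing_upto_unique:
  assumes "decreasing_upto n b" "decreasing_upto n c" "b ` {1..n} = c ` {1..n}" "i \<in> {1..n}"
  shows "b i = c i"
proof -
  have "rev (map b [1..<Suc n]) = rev (map c [1..<Suc n])"
    using assms(1-3) by (intro strict_sorted_equal sorted_map_decreasing)
       (simp_all add: atLeastLessThanSuc_atLeastAtMost del: upt_Suc)
  then have "\<forall>j\<in>set [1..<Suc n]. b j = c j"
    by (simp only: rev_is_rev_conv map_eq_conv)
  then show ?thesis
    using assms(4) by (simp del: upt_Suc)
qed

lemma image_relocate:
  assumes "q \<in> {1..n}" "p \<in> {1..n}"
  shows "relocate c q p v ` {1..n} = insert v (c ` ({1..n} - {q}))"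
proof (intro equalityI subsetI)
  fix x
  assume "x \<in> relocate c q p v ` {1..n}"
  then obtain i where "i \<in> {1..n}" "x = relocate c q p v i"
    by blast
  then show "x \<in> insert v (c ` ({1..n} - {q}))"
    using assms by (auto simp: relocate_def intro!: imageI)
next
  fix x
  assume "x \<in> insert v (c ` ({1..n} - {q}))"
  then consider "x = v" | j where "x = c j" "j \<in> {1..n}" "j \<noteq> q"
    by blast
  then show "x \<in> relocate c q p v ` {1..n}"
  proof cases
    case 1
    then have "x = relocate c q p v p"
      by (simp add: relocate_def)
    then show ?thesis
      using assms by blast
  next
    case (2 j)
    define i where "i = (if p \<le> j \<and> j < q then j + 1 else if q < j \<and> j \<le> p then j - 1 else j)"
    have "x = relocate c q p v i" "i \<in> {1..n}"
      using 2 assms by (auto simp: relocate_def i_def)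
    then show ?thesis
      by blast
  qed
qed

text \<open>
  The position \<open>q\<close> of the entry that was moved can be recovered from the result: \<open>c q\<close> is the only value of
  \<open>c\<close> that has disappeared.
\<close>

lemma relocate_determines_source:
  assumes c: "decreasing_upto n c" and s: "s \<noteq> 0"
    and pq: "q \<in> {1..n}" "p \<in> {1..n}" "q' \<in> {1..n}" "p' \<in> {1..n}"
    and eq: "\<And>i. i \<in> {1..n} \<Longrightarrow> relocate c q p (c q + s) i = relocate c q' p' (c q' + s) i"
  shows "q = q'"
proof -
  have "relocate c q p (c q + s) ` {1..n} = relocate c q' p' (c q' + s) ` {1..n}"
    by (intro image_cong refl eq)
  then have im: "insert (c q + s) (c ` ({1..n} - {q})) = insert (c q' + s) (c ` ({1..n} - {q'}))"
    using pq by (simp only: image_relocate)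
  show ?thesis
  proof (rule ccontr)
    assume "q \<noteq> q'"
    then have "c q \<in> insert (c q + s) (c ` ({1..n} - {q}))"
      using pq unfolding im by blast
    then show False
      using s pq(1) decreasing_upto_inj[OF c, of q] by auto
  qed
qed

text \<open>
  A new value fits into the strictly decreasing sequence that remains when entry \<open>q\<close> is taken out.
\<close>

lemma relocate_exists:
  assumes c: "decreasing_upto n c" and q: "q \<in> {1..n}" and v: "v \<notin> c ` ({1..n} - {q})"
  shows "\<exists>p\<in>{1..n}. decreasing_upto n (relocate c q p v)"
proof -
  \<comment> \<open>The sequence without entry \<open>q\<close>, which has the indices \<open>1, \<dots>, n - 1\<close>.\<close>
  define d where "d k = (if k < q then c k else c (k + 1))" for k
  have d: "d j < d i" if "1 \<le> i" "i < j" "j < n" for i j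
    using that decreasing_uptoD[OF c] q by (auto simp: d_def)
  have dv: "d k \<noteq> v" if "1 \<le> k" "k < n" for k
  proof -
    have "d k \<in> c ` ({1..n} - {q})"
      unfolding d_def using that q by auto
    with v show ?thesis
      by blast
  qed
  \<comment> \<open>The value goes in front of the first smaller entry, and to position \<open>n\<close> if there is none.\<close>
  define p where "p = (LEAST p. 1 \<le> p \<and> (p = n \<or> d p < v))"
  have p: "1 \<le> p \<and> (p = n \<or> d p < v)"
    unfolding p_def by (rule LeastI[of _ n]) (use q in auto)
  have "p \<le> n"
    unfolding p_def by (rule Least_le) (use q in auto)
  have above: "v < d k" if "1 \<le> k" "k < p" for k
    using not_less_Least[of k "\<lambda>p. 1 \<le> p \<and> (p = n \<or> d p < v)"] that dv[of k] \<open>p \<le> n\<close>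
    by (fold p_def) auto
  have below: "d k < v" if "p \<le> k" "k < n" for k
    using p that d[of p k] by (cases "k = p") auto
  have rel: "relocate c q p v i = (if i < p then d i else if i = p then v else d (i - 1))"
    if "1 \<le> i" for i
    using that by (auto simp: relocate_def d_def)
  have "relocate c q p v j < relocate c q p v i" if "1 \<le> i" "i < j" "j \<le> n" for i j
  proof -
    consider "j < p" | "j = p" | "i < p" "p < j" | "i = p" | "p < i"
      using that by linarith
    then show ?thesis
    proof cases
      case 3
      then show ?thesis
        using that less_trans[OF below[of "j - 1"] above[of i]] by (simp add: rel)
    qed (use that above[of i] below[of "j - 1"] d[of i j] d[of "i - 1" "j - 1"] p \<open>p \<le> n\<close> in \<open>auto simp: rel\<close>)
  qed
  then show ?thesis
    using p \<open>p \<le> n\<close> by (intro bexI[of _ p]) (auto simp: decreasing_upto_def)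
qed

section \<open>Beta numbers of a partition\<close>

definition beta :: "nat \<Rightarrow> (nat \<Rightarrow> nat) \<Rightarrow> nat \<Rightarrow> int" where
  "beta n l i = int (l i) + int n - int i"

lemma is_partition_antimono:
  assumes "is_partition l" "1 \<le> i" "i \<le> j"
  shows "l j \<le> l i"
  using assms(3,2)
proof (induction j rule: dec_induct)
  case (step j)
  then have "l (Suc j) \<le> l j"
    using assms(1) by (auto simp: is_partition_def)
  with step show ?case
    by simp
qed simp

lemma decreasing_beta:
  assumes "is_partition l"
  shows "decreasing_upto n (beta n l)"
proof -
  have "beta n l j < beta n l i" if "1 \<le> i" "i < j" for i j
    using that is_partition_antimono[OF assms, of i j] by (simp add: beta_def)
  then show ?thesis
    by (simp add: decreasing_upto_def)
qed

text \<open>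
  A strictly decreasing sequence of \<open>n\<close> nonnegative integers satisfies \<open>b i \<ge> n - i\<close>, so subtracting
  \<open>n - i\<close> leaves natural numbers, and these are weakly decreasing.
\<close>

lemma partition_of_beta:
  assumes dec: "decreasing_upto n b" and nonneg: "\<And>i. i \<in> {1..n} \<Longrightarrow> 0 \<le> b i"
  obtains l where "is_partition l" "length_at_most n l" "\<And>i. i \<in> {1..n} \<Longrightarrow> beta n l i = b i"
proof -
  define l where "l i = (if i \<in> {1..n} then nat (b i - int n + int i) else 0)" for i
  have ge: "int n - int i \<le> b i" if "i \<in> {1..n}" for i
  proof -
    have "i \<le> n" "1 \<le> i"
      using that by auto
    then show ?thesis
    proof (induction i rule: inc_induct)
      case base
      then show ?case
        using nonneg[of n] by simp
    next
      case (step m)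
      then show ?case
        using decreasing_uptoD[OF dec, of m "Suc m"] by simp
    qed
  qed
  have beta: "beta n l i = b i" if "i \<in> {1..n}" for i
    using that ge[OF that] by (simp add: beta_def l_def)
  have "l (Suc i) \<le> l i" if "1 \<le> i" for i
    using that decreasing_uptoD[OF dec, of i "Suc i"] by (auto simp: l_def)
  moreover have "finite {i. l i \<noteq> 0}"
    by (rule finite_subset[of _ "{1..n}"]) (auto simp: l_def)
  ultimately have "is_partition l"
    by (auto simp: is_partition_def l_def)
  moreover have "length_at_most n l"
    by (auto simp: length_at_most_def l_def)
  ultimately show ?thesis
    using beta that by blast
qed

lemma beta_inj:
  assumes "is_partition l" "is_partition m" "length_at_most n l" "length_at_most n m"
    and "\<And>i. i \<in> {1..n} \<Longrightarrow> beta n l i = beta n m i"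
  shows "l = m"
proof
  fix i
  show "l i = m i"
    using assms(1-4) assms(5)[of i]
    by (cases "i = 0"; cases "i \<le> n") (auto simp: is_partition_def length_at_most_def beta_def)
qed

section \<open>Border strips in terms of row lengths\<close>

lemma mem_skew: "(i, j) \<in> skew l m \<longleftrightarrow> 1 \<le> i \<and> m i < j \<and> j \<le> l i"
  by (auto simp: skew_def diagram_def)

lemma diagram_subset_iff: "diagram m \<subseteq> diagram l \<longleftrightarrow> (\<forall>i\<ge>1. m i \<le> l i)"
proof
  assume sub: "diagram m \<subseteq> diagram l"
  show "\<forall>i\<ge>1. m i \<le> l i"
  proof (intro allI impI)
    fix i :: nat
    assume "1 \<le> i"
    then show "m i \<le> l i"
      using subsetD[OF sub, of "(i, m i)"] by (cases "m i = 0") (auto simp: diagram_def)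
  qed
qed (force simp: diagram_def)

lemma border_strip_length_at_most:
  assumes "border_strip r l m" "length_at_most n l"
  shows "length_at_most n m"
  unfolding length_at_most_def
proof (intro allI impI)
  fix i
  assume "n < i"
  have "\<forall>i\<ge>1. m i \<le> l i"
    using assms(1) unfolding border_strip_def diagram_subset_iff by (rule conjunct1)
  then have "m i \<le> l i"
    using \<open>n < i\<close> by simp
  then show "m i = 0"
    using \<open>n < i\<close> assms(2) by (simp add: length_at_most_def)
qed

text \<open>
  The shape of a border strip of size \<open>r\<close> in the rows \<open>p, \<dots>, q\<close>: a row after the first one overlaps the row above it
  in exactly one column, because it must share a side with it but must not form a \<open>2 \<times> 2\<close> block. Then the size
  telescopes to \<open>l p - m q + q - p\<close>, and the last conjunct says that this is \<open>r\<close>.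
\<close>

definition strip_rows :: "nat \<Rightarrow> (nat \<Rightarrow> nat) \<Rightarrow> (nat \<Rightarrow> nat) \<Rightarrow> nat \<Rightarrow> nat \<Rightarrow> bool" where
  "strip_rows r l m p q \<longleftrightarrow> 1 \<le> p \<and> p \<le> q \<and> (\<forall>i\<ge>1. i \<notin> {p..q} \<longrightarrow> l i = m i) \<and>
     (\<forall>i. p < i \<longrightarrow> i \<le> q \<longrightarrow> l i = Suc (m (i - 1))) \<and> l p + q = m q + r + p"

lemma strip_size:
  assumes "p \<le> q" "\<And>i. p < i \<Longrightarrow> i \<le> q \<Longrightarrow> l i = Suc (m (i - 1))"
  shows "(\<Sum>i=p..q. int (l i) - int (m i)) = int (l p) - int (m q) + int q - int p"
  using assms by (induction q rule: dec_induct) (auto simp: sum.nat_ivl_Suc')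

lemma strip_rows_less:
  assumes "is_partition l" "is_partition m" "r \<ge> 1" "strip_rows r l m p q" "p \<le> i" "i \<le> q"
  shows "m i < l i"
proof (cases "i = p")
  case True
  show ?thesis
  proof (cases "p = q")
    case False
    then have "l (Suc p) = Suc (m p)" "l (Suc p) \<le> l p"
      using assms by (auto simp: strip_rows_def is_partition_def)
    then show ?thesis
      using True by simp
  qed (use assms True in \<open>auto simp: strip_rows_def\<close>)
next
  case False
  then have "l i = Suc (m (i - 1))" "m i \<le> m (i - 1)"
    using assms is_partition_antimono[OF assms(2), of "i - 1" i] by (auto simp: strip_rows_def)
  then show ?thesis
    by simp
qed

lemma skew_eq_Sigma:
  assumes "is_partition l" "is_partition m" "r \<ge> 1" "strip_rows r l m p q"
  shows "skew l m = (SIGMA i:{p..q}. {m i<..l i})"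
  using assms(4) by (auto simp: mem_skew strip_rows_def) (metis le_less_trans less_imp_le_nat linorder_not_less less_irrefl)+

lemma fst_skew:
  assumes "is_partition l" "is_partition m" "r \<ge> 1" "strip_rows r l m p q"
  shows "fst ` skew l m = {p..q}"
  using strip_rows_less[OF assms] unfolding skew_eq_Sigma[OF assms] by force

lemma card_skew:
  assumes "is_partition l" "is_partition m" "r \<ge> 1" "strip_rows r l m p q"
  shows "card (skew l m) = r"
proof -
  have "int (card (skew l m)) = (\<Sum>i=p..q. int (l i) - int (m i))"
    unfolding skew_eq_Sigma[OF assms]
    by (subst card_SigmaI) (auto intro!: sum.cong simp: of_nat_diff less_imp_le strip_rows_less[OF assms])
  also have "\<dots> = int r"
    using assms(4) by (subst strip_size) (auto simp: strip_rows_def)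
  finally show ?thesis
    by simp
qed

text \<open>
  Every box is joined to the first box of the strip in the last row \<open>q\<close>: within a row one can walk left to the first box
  of the strip, and right below that box lies the last box of the next row.
\<close>

lemma connected_strip:
  assumes "is_partition l" "is_partition m" "r \<ge> 1" "strip_rows r l m p q"
  shows "connected_boxes (skew l m)"
proof -
  define R where "R = {(u, v). u \<in> skew l m \<and> v \<in> skew l m \<and> share_side u v}"
  have "share_side u v \<Longrightarrow> share_side v u" for u v
    by (cases u; cases v) auto
  then have "sym R"
    by (auto simp: sym_def R_def)
  have row: "((i, j), (i, Suc (m i))) \<in> R\<^sup>*" if "1 \<le> i" "Suc (m i) \<le> j" "j \<le> l i" for i j
    using that(2,3)
  proof (induction j rule: dec_induct)
    case (step j)
    then have "((i, Suc j), (i, j)) \<in> R"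
      using that(1) by (auto simp: R_def mem_skew)
    with step show ?case
      by (meson Suc_leD converse_rtrancl_into_rtrancl)
  qed simp
  have down: "((i, Suc (m i)), (q, Suc (m q))) \<in> R\<^sup>*" if "p \<le> i" "i \<le> q" for i
    using that(2,1)
  proof (induction i rule: inc_induct)
    case (step i)
    have less: "m i < l i" "m (Suc i) < l (Suc i)"
      using strip_rows_less[OF assms] step by auto
    have eq: "l (Suc i) = Suc (m i)" "1 \<le> i"
      using assms(4) step by (auto simp: strip_rows_def)
    have "((i, Suc (m i)), (Suc i, Suc (m i))) \<in> R"
      using less eq by (auto simp: R_def mem_skew)
    also have "((Suc i, Suc (m i)), (Suc i, Suc (m (Suc i)))) \<in> R\<^sup>*"
      using less eq by (intro row) auto
    also have "((Suc i, Suc (m (Suc i))), (q, Suc (m q))) \<in> R\<^sup>*"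
      using step by simp
    finally show ?case .
  qed simp
  have to_end: "(b, (q, Suc (m q))) \<in> R\<^sup>*" if b: "b \<in> skew l m" for b
  proof -
    obtain i j where ij: "b = (i, j)"
      by (cases b)
    have "p \<le> i" "i \<le> q" "1 \<le> i" "m i < j" "j \<le> l i"
      using b skew_eq_Sigma[OF assms] mem_skew[of i j l m] by (auto simp: ij)
    then show ?thesis
      unfolding ij by (intro rtrancl_trans[OF row down]) auto
  qed
  have "(b, c) \<in> R\<^sup>*" if "b \<in> skew l m" "c \<in> skew l m" for b c
    using to_end[OF that(1)] to_end[OF that(2)] sym_rtrancl[OF \<open>sym R\<close>]
    by (meson rtrancl_trans symD)
  then show ?thesis
    unfolding connected_boxes_def R_def by blast
qed

lemma strip_rows_imp_border_strip:
  assumes "is_partition l" "is_partition m" "r \<ge> 1" "strip_rows r l m p q"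
  shows "border_strip r l m"
proof -
  have rows: "(i \<in> {p..q} \<longrightarrow> m i < l i) \<and> (1 \<le> i \<longrightarrow> i \<notin> {p..q} \<longrightarrow> l i = m i)" for i
    using strip_rows_less[OF assms] assms(4) by (auto simp: strip_rows_def)
  have "diagram m \<subseteq> diagram l"
    unfolding diagram_subset_iff using rows by (metis less_imp_le order_refl)
  moreover have "\<not> has_2x2_block (skew l m)"
  proof
    assume "has_2x2_block (skew l m)"
    then obtain i j where ij: "(i, j) \<in> skew l m" "(Suc i, Suc j) \<in> skew l m"
      unfolding has_2x2_block_def by blast
    then have "p \<le> i" "Suc i \<le> q" "m i < j" "Suc j \<le> l (Suc i)"
      unfolding skew_eq_Sigma[OF assms] by auto
    then show False
      using assms(4) by (auto simp: strip_rows_def)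
  qed
  moreover have "skew l m \<noteq> {}"
    using card_skew[OF assms] assms(3) by auto
  ultimately show ?thesis
    using card_skew[OF assms] connected_strip[OF assms] by (simp add: border_strip_def)
qed

text \<open>
  With \<open>p\<close> and \<open>q\<close> the first and the last row that the strip meets, a path from row \<open>p\<close> to row \<open>q\<close> has to step from each
  row \<open>i < q\<close> to the next one within one column. Hence row \<open>i + 1\<close> of \<open>l\<close> is longer than row \<open>i\<close> of \<open>m\<close>; if it were
  longer by two or more, there would be a \<open>2 \<times> 2\<close> block.
\<close>

lemma border_strip_imp_strip_rows:
  assumes l: "is_partition l" and m: "is_partition m" and r: "r \<ge> 1" and strip: "border_strip r l m"
  obtains p q where "strip_rows r l m p q"
proof -
  define S where "S = skew l m"
  have S: "S \<noteq> {}" "connected_boxes S" "\<not> has_2x2_block S" "card S = r" "diagram m \<subseteq> diagram l"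
    using strip by (auto simp: border_strip_def S_def)
  have le: "m i \<le> l i" if "1 \<le> i" for i
    using S(5) that by (simp add: diagram_subset_iff)
  have fin: "finite S"
    using S(4) r by (intro card_ge_0_finite) simp
  have memS: "(i, j) \<in> S \<longleftrightarrow> 1 \<le> i \<and> m i < j \<and> j \<le> l i" for i j
    by (simp add: S_def mem_skew)
  define p where "p = Min (fst ` S)"
  define q where "q = Max (fst ` S)"
  have "p \<in> fst ` S" "q \<in> fst ` S"
    unfolding p_def q_def using S(1) fin by (auto intro!: Min_in Max_in)
  then obtain jp jq where pq: "(p, jp) \<in> S" "(q, jq) \<in> S"
    by force
  have bounds: "p \<le> i" "i \<le> q" if "(i, j) \<in> S" for i j
    unfolding p_def q_def using that fin by (force intro!: Min_le Max_ge)+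
  have outside: "l i = m i" if "1 \<le> i" "i \<notin> {p..q}" for i
  proof (rule ccontr)
    assume "l i \<noteq> m i"
    then have "(i, l i) \<in> S"
      using le[OF that(1)] that(1) by (simp add: memS)
    then show False
      using bounds that(2) by auto
  qed
  have next_row: "l (Suc i) = Suc (m i)" if i: "p \<le> i" "i < q" for i
  proof (rule antisym)
    have "1 \<le> i"
      using pq(1) i(1) by (simp add: memS)
    show "l (Suc i) \<le> Suc (m i)"
    proof (rule ccontr)
      assume "\<not> l (Suc i) \<le> Suc (m i)"
      moreover have "l (Suc i) \<le> l i" "m (Suc i) \<le> m i"
        using l m \<open>1 \<le> i\<close> by (auto simp: is_partition_def)
      ultimately have "{(i, Suc (m i)), (i, Suc (Suc (m i))), (Suc i, Suc (m i)), (Suc i, Suc (Suc (m i)))} \<subseteq> S"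
        using \<open>1 \<le> i\<close> by (auto simp: memS)
      then show False
        using S(3) unfolding has_2x2_block_def by blast
    qed
    show "Suc (m i) \<le> l (Suc i)"
    proof (rule ccontr)
      assume gap: "\<not> Suc (m i) \<le> l (Suc i)"
      \<comment> \<open>No step leads from row \<open>i\<close> to row \<open>i + 1\<close>, so a path from row \<open>p\<close> never gets below row \<open>i\<close>.\<close>
      have "fst c \<le> i" if "((p, jp), c) \<in> {(u, v). u \<in> S \<and> v \<in> S \<and> share_side u v}\<^sup>*" for c
        using that
      proof (induction rule: rtrancl_induct)
        case (step b c)
        obtain a j a' j' where bc: "b = (a, j)" "c = (a', j')"
          by (cases b; cases c)
        show ?case
          using step gap by (cases "a = i") (auto simp: bc memS)
      qed (use i in simp)
      moreover have "((p, jp), (q, jq)) \<in> {(u, v). u \<in> S \<and> v \<in> S \<and> share_side u v}\<^sup>*"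
        using S(2) pq unfolding connected_boxes_def by blast
      ultimately show False
        using i(2) by fastforce
    qed
  qed
  have pq_le: "p \<le> q" "1 \<le> p"
    using bounds[OF pq(1)] pq(1) by (auto simp: memS)
  have inside: "l i = Suc (m (i - 1))" if "p < i" "i \<le> q" for i
    using next_row[of "i - 1"] that by simp
  have "S = (SIGMA i:{p..q}. {m i<..l i})"
    using bounds pq_le by (auto simp: memS)
  then have "r = (\<Sum>i=p..q. card {m i<..l i})"
    using S(4) by (simp add: card_SigmaI)
  then have "int r = (\<Sum>i=p..q. int (card {m i<..l i}))"
    by simp
  also have "\<dots> = (\<Sum>i=p..q. int (l i) - int (m i))"
    using le pq_le by (intro sum.cong) (auto simp: of_nat_diff)
  also have "\<dots> = int (l p) - int (m q) + int q - int p"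
    using pq_le inside by (intro strip_size) auto
  finally have "l p + q = m q + r + p"
    by linarith
  then have "strip_rows r l m p q"
    using pq_le outside inside by (auto simp: strip_rows_def)
  then show ?thesis
    using that by blast
qed

lemma height_strip:
  assumes "is_partition l" "is_partition m" "r \<ge> 1" "strip_rows r l m p q"
  shows "height l m = q - p"
  using fst_skew[OF assms] assms(4) by (simp add: height_def strip_rows_def)

text \<open>
  In terms of beta numbers, \<open>l i = m (i - 1) + 1\<close> says that entry \<open>i - 1\<close> of \<open>m\<close> has become entry \<open>i\<close> of \<open>l\<close>. So adding
  a strip in the rows \<open>p, \<dots>, q\<close> raises entry \<open>q\<close> by \<open>r\<close> and moves it up to position \<open>p\<close>. The next lemma reads the same
  shape from \<open>l\<close>: removing the strip lowers entry \<open>p\<close> by \<open>r\<close> and moves it down to position \<open>q\<close>.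
\<close>

lemma strip_rows_iff_add:
  assumes "length_at_most n l" "length_at_most n m"
    and "1 \<le> p" "p \<le> q" "q \<le> n"
  shows "strip_rows r l m p q \<longleftrightarrow>
    (\<forall>i\<in>{1..n}. beta n l i = relocate (beta n m) q p (beta n m q + int r) i)"
proof
  assume "strip_rows r l m p q"
  then show "\<forall>i\<in>{1..n}. beta n l i = relocate (beta n m) q p (beta n m q + int r) i"
    by (auto simp: strip_rows_def relocate_def beta_def)
next
  assume eq: "\<forall>i\<in>{1..n}. beta n l i = relocate (beta n m) q p (beta n m q + int r) i"
  have "l i = m i" if "1 \<le> i" "i \<notin> {p..q}" for i
    using that eq[rule_format, of i] assms
    by (cases "i \<le> n") (auto simp: relocate_def beta_def length_at_most_def)
  moreover have "l i = Suc (m (i - 1))" if "p < i" "i \<le> q" for i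
    using that eq[rule_format, of i] assms by (auto simp: relocate_def beta_def)
  moreover have "l p + q = m q + r + p"
    using eq[rule_format, of p] assms by (auto simp: relocate_def beta_def)
  ultimately show "strip_rows r l m p q"
    using assms by (auto simp: strip_rows_def)
qed

lemma strip_rows_iff_remove:
  assumes "length_at_most n l" "length_at_most n m"
    and "1 \<le> p" "p \<le> q" "q \<le> n"
  shows "strip_rows r l m p q \<longleftrightarrow>
    (\<forall>i\<in>{1..n}. beta n m i = relocate (beta n l) p q (beta n l p - int r) i)"
proof
  assume "strip_rows r l m p q"
  then show "\<forall>i\<in>{1..n}. beta n m i = relocate (beta n l) p q (beta n l p - int r) i"
    by (auto simp: strip_rows_def relocate_def beta_def)
next
  assume eq: "\<forall>i\<in>{1..n}. beta n m i = relocate (beta n l) p q (beta n l p - int r) i"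
  have "l i = m i" if "1 \<le> i" "i \<notin> {p..q}" for i
    using that eq[rule_format, of i] assms
    by (cases "i \<le> n") (auto simp: relocate_def beta_def length_at_most_def)
  moreover have "l i = Suc (m (i - 1))" if "p < i" "i \<le> q" for i
    using that eq[rule_format, of "i - 1"] assms by (cases i) (auto simp: relocate_def beta_def)
  moreover have "l p + q = m q + r + p"
    using eq[rule_format, of q] assms by (auto simp: relocate_def beta_def)
  ultimately show "strip_rows r l m p q"
    using assms by (auto simp: strip_rows_def)
qed

lemma strip_rows_bound:
  assumes "is_partition l" "is_partition m" "r \<ge> 1" "strip_rows r l m p q" "length_at_most n l"
  shows "q \<le> n"
proof (rule ccontr)
  assume "\<not> q \<le> n"
  then show False
    using strip_rows_less[OF assms(1-4), of q] assms(4,5)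
    by (simp add: strip_rows_def length_at_most_def)
qed

text \<open>
  Since a sum over an infinite set is \<open>0\<close> by convention, finiteness is needed before the partitions
  with more than \<open>n\<close> rows can be discarded from the sum over the added strips. A strip of size \<open>r\<close> cannot lengthen a row by
  more than \<open>r\<close> boxes, nor have boxes in the first column in more than \<open>r\<close> new rows.
\<close>

lemma finite_border_strips:
  assumes "length_at_most n m" "r \<ge> 1"
  shows "finite {l. is_partition l \<and> border_strip r l m}"
proof (rule finite_subset)
  define K where "K = (\<Sum>i\<le>n. m i) + r"
  show "{l. is_partition l \<and> border_strip r l m} \<subseteq>
      {l. \<forall>i. (i \<in> {..n + r} \<longrightarrow> l i \<in> {..K}) \<and> (i \<notin> {..n + r} \<longrightarrow> l i = 0)}"
  proof (intro subsetI CollectI allI conjI impI)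
    fix l i
    assume "l \<in> {l. is_partition l \<and> border_strip r l m}"
    then have l: "is_partition l" and card: "card (skew l m) = r"
      by (auto simp: border_strip_def)
    have fin: "finite (skew l m)"
      using card assms(2) by (intro card_ge_0_finite) simp
    show "l i \<in> {..K}"
    proof (cases "i = 0")
      case False
      have "card (Pair i ` {m i<..l i}) \<le> r"
        unfolding card[symmetric] using fin False by (intro card_mono) (auto simp: mem_skew)
      then have "l i - m i \<le> r"
        by (simp add: card_image inj_on_def)
      moreover have "m i \<le> (\<Sum>i\<le>n. m i)"
        using assms(1) by (cases "i \<le> n") (auto simp: length_at_most_def intro: member_le_sum)
      ultimately show ?thesis
        by (simp add: K_def)
    qed (use l in \<open>simp add: is_partition_def\<close>)
    show "l i = 0" if "i \<notin> {..n + r}"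
    proof (rule ccontr)
      assume "l i \<noteq> 0"
      then have "1 \<le> l k" if "k \<in> {Suc n..i}" for k
        using is_partition_antimono[OF l, of k i] that by auto
      then have "(\<lambda>k. (k, 1)) ` {Suc n..i} \<subseteq> skew l m"
        using assms(1) by (auto simp: mem_skew length_at_most_def)
      then have "card ((\<lambda>k. (k, 1::nat)) ` {Suc n..i}) \<le> r"
        unfolding card[symmetric] by (intro card_mono fin)
      moreover have "card ((\<lambda>k. (k, 1::nat)) ` {Suc n..i}) = i - n"
        by (simp add: card_image inj_on_def)
      ultimately show False
        using that by simp
    qed
  qed
qed (intro finite_set_of_finite_funs finite_atMost)

section \<open>Moving one beta number\<close>

text \<open>
  If \<open>v\<close> were one of the other values, only \<open>n - 1\<close> values would be left for \<open>n\<close> distinct entries.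
\<close>

lemma relocate_decreasing_imp_new:
  assumes "q \<in> {1..n}" "p \<in> {1..n}" "decreasing_upto n (relocate c q p v)"
  shows "v \<notin> c ` ({1..n} - {q})"
proof
  assume "v \<in> c ` ({1..n} - {q})"
  then have "relocate c q p v ` {1..n} = c ` ({1..n} - {q})"
    unfolding image_relocate[OF assms(1,2)] by blast
  moreover have "card (relocate c q p v ` {1..n}) = n"
    using decreasing_upto_inj[OF assms(3)] by (subst card_image) (auto intro!: inj_onI)
  moreover have "card (c ` ({1..n} - {q})) \<le> card ({1..n} - {q})"
    by (rule card_image_le) simp
  ultimately show False
    using assms(1) by auto
qed

definition moved_to :: "nat \<Rightarrow> (nat \<Rightarrow> int) \<Rightarrow> int \<Rightarrow> nat \<Rightarrow> nat \<Rightarrow> (nat \<Rightarrow> nat) \<Rightarrow> bool" where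
  "moved_to n c s q p l \<longleftrightarrow> is_partition l \<and> length_at_most n l \<and> q \<in> {1..n} \<and> p \<in> {1..n} \<and>
     (\<forall>i\<in>{1..n}. beta n l i = relocate c q p (c q + s) i)"

text \<open>
  Adding \<open>s\<close> to entry \<open>q\<close> gives a vanishing alternant if the new value is also another entry. The other positions \<open>q\<close>
  with nonnegative new value correspond bijectively to the partitions that can be reached. The sign is
  expressed by a function \<open>ht\<close> of the partition alone, which will be the height of the strip added or removed.
\<close>

lemma sum_alternant_moves:
  assumes c: "decreasing_upto n c" and nonneg: "\<And>i. i \<in> {1..n} \<Longrightarrow> 0 \<le> c i" and s: "s \<noteq> 0"
    and sign: "\<And>q p l. moved_to n c s q p l \<Longrightarrow> (-1) ^ ht l = ((-1) ^ (p + q) :: 'k::field)"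
  shows "(\<Sum>q | q \<in> {1..n} \<and> 0 \<le> c q + s. alternant y n (c(q := c q + s))) =
    (\<Sum>l | \<exists>q p. moved_to n c s q p l. (-1) ^ ht l * alternant y n (beta n l) :: 'k)"
proof -
  define M where "M = {l. \<exists>q p. moved_to n c s q p l}"
  define Q where "Q = {q \<in> {1..n}. 0 \<le> c q + s \<and> c q + s \<notin> c ` ({1..n} - {q})}"
  \<comment> \<open>The partition determines \<open>q\<close>, and \<open>q\<close> determines the set of beta numbers and with it the partition.\<close>
  define source where "source l = (SOME q. \<exists>p. moved_to n c s q p l)" for l
  have source: "\<exists>p. moved_to n c s (source l) p l" if "l \<in> M" for l
    using that someI_ex[of "\<lambda>q. \<exists>p. moved_to n c s q p l"] by (simp add: M_def source_def)
  have dec: "decreasing_upto n (relocate c q p (c q + s))" if "moved_to n c s q p l" for q p l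
    using decreasing_beta[of l n] that by (auto simp: moved_to_def decreasing_upto_def)
  have "bij_betw source M Q"
    unfolding bij_betw_def
  proof (intro conjI equalityI subsetI inj_onI)
    fix l l'
    assume l: "l \<in> M" "l' \<in> M" and eq: "source l = source l'"
    obtain p p' where mv: "moved_to n c s (source l) p l" "moved_to n c s (source l) p' l'"
      using source[OF l(1)] source[OF l(2)] eq by metis
    have im: "beta n k ` {1..n} = insert (c q + s) (c ` ({1..n} - {q}))"
      if "moved_to n c s q p k" for q p k
    proof -
      have "beta n k ` {1..n} = relocate c q p (c q + s) ` {1..n}"
        using that by (intro image_cong) (auto simp: moved_to_def)
      then show ?thesis
        using that by (simp only: image_relocate moved_to_def)
    qed
    have "beta n l ` {1..n} = beta n l' ` {1..n}"
      using im[OF mv(1)] im[OF mv(2)] by simp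
    then have "beta n l i = beta n l' i" if "i \<in> {1..n}" for i
      using mv decreasing_upto_unique[OF decreasing_beta decreasing_beta _ that]
      by (auto simp: moved_to_def)
    then show "l = l'"
      using mv by (intro beta_inj[of l l' n]) (auto simp: moved_to_def)
  next
    fix q
    assume "q \<in> source ` M"
    then obtain l p where mv: "moved_to n c s q p l"
      using source by blast
    then have "c q + s = beta n l p" "p \<le> n"
      by (auto simp: moved_to_def relocate_def)
    then have "0 \<le> c q + s"
      by (simp add: beta_def)
    then show "q \<in> Q"
      using mv relocate_decreasing_imp_new[OF _ _ dec[OF mv]] by (auto simp: Q_def moved_to_def)
  next
    fix q
    assume q: "q \<in> Q"
    then obtain p where p: "p \<in> {1..n}" "decreasing_upto n (relocate c q p (c q + s))"
      using relocate_exists[OF c, of q "c q + s"] by (auto simp: Q_def)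
    have "relocate c q p (c q + s) ` {1..n} \<subseteq> {0..}"
      using q p nonneg by (subst image_relocate) (auto simp: Q_def)
    then have "0 \<le> relocate c q p (c q + s) i" if "i \<in> {1..n}" for i
      using that by blast
    then obtain l where "is_partition l" "length_at_most n l"
        "\<And>i. i \<in> {1..n} \<Longrightarrow> beta n l i = relocate c q p (c q + s) i"
      using partition_of_beta[OF p(2)] by metis
    then have mv: "moved_to n c s q p l"
      using q p by (auto simp: moved_to_def Q_def)
    then have "l \<in> M"
      by (auto simp: M_def)
    then obtain p' where mv': "moved_to n c s (source l) p' l"
      using source by blast
    have "q = source l"
      using mv mv' by (intro relocate_determines_source[OF c s, of q p "source l" p']) (auto simp: moved_to_def)
    then show "q \<in> source ` M"
      using \<open>l \<in> M\<close> by blast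
  qed
  have "(\<Sum>q | q \<in> {1..n} \<and> 0 \<le> c q + s. alternant y n (c(q := c q + s))) =
      (\<Sum>q\<in>Q. alternant y n (c(q := c q + s)))"
  proof (rule sum.mono_neutral_right)
    show "\<forall>q\<in>{q. q \<in> {1..n} \<and> 0 \<le> c q + s} - Q. alternant y n (c(q := c q + s)) = 0"
    proof
      fix q
      assume "q \<in> {q. q \<in> {1..n} \<and> 0 \<le> c q + s} - Q"
      then obtain j where "q \<in> {1..n}" "j \<in> {1..n}" "j \<noteq> q" "c q + s = c j"
        unfolding Q_def by blast
      then show "alternant y n (c(q := c q + s)) = 0"
        by (intro alternant_repeated[of q n j]) auto
    qed
  qed (auto simp: Q_def)
  also have "\<dots> = (\<Sum>l\<in>M. alternant y n (c(source l := c (source l) + s)))"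
    by (rule sum.reindex_bij_betw[OF \<open>bij_betw source M Q\<close>, symmetric])
  also have "\<dots> = (\<Sum>l\<in>M. (-1) ^ ht l * alternant y n (beta n l))"
  proof (rule sum.cong)
    fix l
    assume "l \<in> M"
    then obtain p where mv: "moved_to n c s (source l) p l"
      using source by blast
    then have "alternant y n (c(source l := c (source l) + s)) =
        (-1) ^ (p + source l) * alternant y n (relocate c (source l) p (c (source l) + s))"
      by (intro alternant_relocate) (auto simp: moved_to_def)
    also have "alternant y n (relocate c (source l) p (c (source l) + s)) = alternant y n (beta n l)"
      using mv by (intro alternant_cong) (auto simp: moved_to_def)
    finally show "alternant y n (c(source l := c (source l) + s)) = (-1) ^ ht l * alternant y n (beta n l)"
      by (simp only: sign[OF mv])
  qed simp
  finally show ?thesis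
    by (simp add: M_def)
qed

text \<open>
  Raising an entry can only move it to the left. So \<open>p \<le> q\<close> is automatic here, and likewise in the lemma on removal, where
  the entry moves from \<open>p\<close> to the right.
\<close>

lemma moved_to_add_iff:
  assumes "is_partition m" "length_at_most n m" "r \<ge> 1"
  shows "moved_to n (beta n m) (int r) q p l \<longleftrightarrow>
    is_partition l \<and> length_at_most n l \<and> strip_rows r l m p q"
proof
  assume mv: "moved_to n (beta n m) (int r) q p l"
  then have l: "is_partition l" "length_at_most n l" and pq: "q \<in> {1..n}" "p \<in> {1..n}"
    and eq: "\<And>i. i \<in> {1..n} \<Longrightarrow> beta n l i = relocate (beta n m) q p (beta n m q + int r) i"
    by (auto simp: moved_to_def)
  have "p \<le> q"
  proof (rule ccontr)
    assume "\<not> p \<le> q"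
    then have "beta n l p < beta n l q" "beta n m (q + 1) < beta n m q"
      using pq decreasing_uptoD[OF decreasing_beta[OF l(1)], of q p]
        decreasing_uptoD[OF decreasing_beta[OF assms(1)], of q "q + 1" n] by auto
    moreover have "beta n l p = beta n m q + int r" "beta n l q = beta n m (q + 1)"
      using eq pq \<open>\<not> p \<le> q\<close> by (auto simp: relocate_def)
    ultimately show False
      by simp
  qed
  then show "is_partition l \<and> length_at_most n l \<and> strip_rows r l m p q"
    using strip_rows_iff_add[of n l m p q r] assms l pq eq by simp
next
  assume "is_partition l \<and> length_at_most n l \<and> strip_rows r l m p q"
  then have l: "is_partition l" "length_at_most n l" and strip: "strip_rows r l m p q"
    by auto
  have pq: "1 \<le> p" "p \<le> q" "q \<le> n"
    using strip strip_rows_bound[OF l(1) assms(1,3) strip l(2)] by (auto simp: strip_rows_def)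
  then show "moved_to n (beta n m) (int r) q p l"
    using strip_rows_iff_add[OF l(2) assms(2) pq, of r] l strip
    by (auto simp: moved_to_def)
qed

lemma moved_to_remove_iff:
  assumes "is_partition l" "length_at_most n l" "r \<ge> 1"
  shows "moved_to n (beta n l) (- int r) p q m \<longleftrightarrow>
    is_partition m \<and> length_at_most n m \<and> strip_rows r l m p q"
proof
  assume mv: "moved_to n (beta n l) (- int r) p q m"
  then have m: "is_partition m" "length_at_most n m" and pq: "q \<in> {1..n}" "p \<in> {1..n}"
    and eq: "\<And>i. i \<in> {1..n} \<Longrightarrow> beta n m i = relocate (beta n l) p q (beta n l p - int r) i"
    by (auto simp: moved_to_def)
  have "p \<le> q"
  proof (rule ccontr)
    assume "\<not> p \<le> q"
    then have "beta n m p < beta n m q" "beta n l p < beta n l (p - 1)"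
      using pq decreasing_uptoD[OF decreasing_beta[OF m(1)], of q p]
        decreasing_uptoD[OF decreasing_beta[OF assms(1)], of "p - 1" p n] by auto
    moreover have "beta n m q = beta n l p - int r" "beta n m p = beta n l (p - 1)"
      using eq pq \<open>\<not> p \<le> q\<close> by (auto simp: relocate_def)
    ultimately show False
      by simp
  qed
  then show "is_partition m \<and> length_at_most n m \<and> strip_rows r l m p q"
    using strip_rows_iff_remove[of n l m p q r] assms m pq eq by simp
next
  assume "is_partition m \<and> length_at_most n m \<and> strip_rows r l m p q"
  then have m: "is_partition m" "length_at_most n m" and strip: "strip_rows r l m p q"
    by auto
  have pq: "1 \<le> p" "p \<le> q" "q \<le> n"
    using strip strip_rows_bound[OF assms(1) m(1) assms(3) strip assms(2)]
    by (auto simp: strip_rows_def)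
  then show "moved_to n (beta n l) (- int r) p q m"
    using strip_rows_iff_remove[OF assms(2) m(2) pq, of r] m strip
    by (auto simp: moved_to_def)
qed

lemma height_sign:
  assumes "is_partition l" "is_partition m" "r \<ge> 1" "strip_rows r l m p q"
  shows "(-1) ^ height l m = ((-1) ^ (p + q) :: 'k::field)"
proof -
  have "p \<le> q"
    using assms(4) by (simp add: strip_rows_def)
  then have "even (height l m) \<longleftrightarrow> even (p + q)"
    unfolding height_strip[OF assms] by auto
  then show ?thesis
    by (simp add: minus_one_power_iff)
qed

lemma border_strip_iff_strip_rows:
  assumes "is_partition l" "is_partition m" "r \<ge> 1"
  shows "border_strip r l m \<longleftrightarrow> (\<exists>p q. strip_rows r l m p q)"
  using border_strip_imp_strip_rows strip_rows_imp_border_strip assms by metis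

lemma sum_alternant_add_strips:
  fixes y :: "nat \<Rightarrow> 'k::field"
  assumes "is_partition m" "length_at_most n m" "r \<ge> 1"
  shows "(\<Sum>q=1..n. alternant y n ((beta n m)(q := beta n m q + int r))) =
    (\<Sum>l | is_partition l \<and> border_strip r l m \<and> length_at_most n l.
       (-1) ^ height l m * alternant y n (beta n l))"
proof -
  have beta_nonneg: "0 \<le> beta n m i" if "i \<in> {1..n}" for i
    using that by (simp add: beta_def)
  have "(\<Sum>q=1..n. alternant y n ((beta n m)(q := beta n m q + int r))) =
    (\<Sum>q | q \<in> {1..n} \<and> 0 \<le> beta n m q + int r.
      alternant y n ((beta n m)(q := beta n m q + int r)))"
    using beta_nonneg by (intro sum.cong) force+
  also have "\<dots> = (\<Sum>l | \<exists>q p. moved_to n (beta n m) (int r) q p l.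
      (-1) ^ height l m * alternant y n (beta n l))"
    using assms beta_nonneg
    by (intro sum_alternant_moves decreasing_beta) (auto simp: moved_to_add_iff height_sign)
  also have "{l. \<exists>q p. moved_to n (beta n m) (int r) q p l} =
      {l. is_partition l \<and> border_strip r l m \<and> length_at_most n l}"
    using assms by (auto simp: moved_to_add_iff border_strip_iff_strip_rows) blast+
  finally show ?thesis .
qed

lemma sum_alternant_remove_strips:
  fixes y :: "nat \<Rightarrow> 'k::field"
  assumes "is_partition l" "length_at_most n l" "r \<ge> 1"
  shows "(\<Sum>p | p \<in> {1..n} \<and> int r \<le> beta n l p.
       alternant y n ((beta n l)(p := beta n l p - int r))) =
    (\<Sum>m | is_partition m \<and> border_strip r l m.
       (-1) ^ height l m * alternant y n (beta n m))"
proof -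
  have "(\<Sum>p | p \<in> {1..n} \<and> int r \<le> beta n l p.
       alternant y n ((beta n l)(p := beta n l p - int r))) =
    (\<Sum>p | p \<in> {1..n} \<and> 0 \<le> beta n l p + - int r.
       alternant y n ((beta n l)(p := beta n l p + - int r)))"
    by simp
  also have "\<dots> = (\<Sum>m | \<exists>p q. moved_to n (beta n l) (- int r) p q m.
      (-1) ^ height l m * alternant y n (beta n m))"
    using assms
    by (intro sum_alternant_moves decreasing_beta)
       (auto simp: moved_to_remove_iff height_sign add.commute beta_def)
  also have "{m. \<exists>p q. moved_to n (beta n l) (- int r) p q m} =
      {m. is_partition m \<and> border_strip r l m}"
    using assms by (auto simp: moved_to_remove_iff border_strip_iff_strip_rows
      dest: border_strip_length_at_most[OF _ assms(2)]) blast+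
  finally show ?thesis .
qed

section \<open>Odd orthogonal characters as quotients of alternants\<close>

lemma sqrt_x_nonzero: "(sqrt_x i :: 'a::idom ratfun) \<noteq> 0"
proof -
  have "Poly_Mapping.single (Poly_Mapping.single i (1::nat)) (1::'a) \<noteq> 0"
    by (metis lookup_single_eq lookup_zero one_neq_zero)
  then show ?thesis
    by (simp add: sqrt_x_def Zero_fract_def eq_fract)
qed

lemma so_det_eq_alternant: "(so_det n l :: 'a::idom ratfun) = alternant sqrt_x n (beta n l)"
proof -
  have entry: "(sqrt_x (Suc i) :: 'a ratfun) ^ (2 * (l (Suc j) + (n - Suc j)) + 1)
        - inverse (sqrt_x (Suc i)) ^ (2 * (l (Suc j) + (n - Suc j)) + 1) =
      sqrt_x (Suc i) powi (2 * beta n l (Suc j) + 1) - sqrt_x (Suc i) powi - (2 * beta n l (Suc j) + 1)"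
    if "j < n" for i j
  proof -
    have exponent: "2 * beta n l (Suc j) + 1 = int (2 * (l (Suc j) + (n - Suc j)) + 1)"
      using that by (simp add: beta_def of_nat_diff)
    show ?thesis
      unfolding exponent by (simp only: power_int_of_nat power_int_minus power_inverse)
  qed
  show ?thesis
    unfolding so_det_def alternant_def
    by (intro arg_cong[of _ _ det] cong_mat refl) (simp only: prod.case entry)
qed

lemma so_eq: "length_at_most n l \<Longrightarrow> (so n l :: 'a::idom ratfun) = alternant sqrt_x n (beta n l) / so_det n (\<lambda>_. 0)"
  by (simp add: so_def so_det_eq_alternant)

section \<open>The reflected terms\<close>

lemma shifted_eq: "shifted n m i = of_int (beta n m i) + 1 / 2"
  by (simp add: shifted_def delta_def beta_def)

text \<open>
  Comparing a half-integer with an integer amounts to comparing its integer part.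
\<close>

lemma half_le_iff: "(of_int k :: rat) \<le> of_int c + 1 / 2 \<longleftrightarrow> k \<le> c"
proof
  assume "(of_int k :: rat) \<le> of_int c + 1 / 2"
  then have "(of_int k :: rat) < of_int (c + 1)"
    by simp
  then show "k \<le> c"
    by (simp only: of_int_less_iff)
next
  assume "k \<le> c"
  then have "(of_int k :: rat) \<le> of_int c"
    by simp
  then show "(of_int k :: rat) \<le> of_int c + 1 / 2"
    by simp
qed

text \<open>
  As the beta numbers decrease, those that are at least \<open>r\<close> occupy an initial segment of the positions, and
  \<open>m_o\<close> is its length.
\<close>

lemma interval_m_o:
  assumes "is_partition m"
  shows "{m_o n r m + 1..n} = {q \<in> {1..n}. beta n m q < int r}"
proof -
  have shifted: "of_nat r \<le> shifted n m i \<longleftrightarrow> int r \<le> beta n m i" for i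
    using half_le_iff[of "int r" "beta n m i"] by (simp add: shifted_eq)
  define A where "A = {i \<in> {1..n}. int r \<le> beta n m i}"
  have m_o: "m_o n r m = (if A = {} then 0 else Max A)"
    unfolding m_o_def shifted not_le[symmetric] by (auto simp: A_def)
  have mem: "m_o n r m < q \<longleftrightarrow> beta n m q < int r" if q: "q \<in> {1..n}" for q
  proof
    assume "m_o n r m < q"
    have "q \<notin> A"
    proof
      assume "q \<in> A"
      moreover have "finite A"
        by (simp add: A_def)
      ultimately have "q \<le> Max A" "m_o n r m = Max A"
        using m_o by auto
      then show False
        using \<open>m_o n r m < q\<close> by simp
    qed
    then show "beta n m q < int r"
      using q by (auto simp: A_def)
  next
    assume small: "beta n m q < int r"
    show "m_o n r m < q"
    proof (cases "A = {}")
      case False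
      then have "Max A \<in> A"
        by (intro Max_in) (auto simp: A_def)
      then have "\<not> q \<le> Max A"
        using small q decreasing_uptoD[OF decreasing_beta[OF assms], of q "Max A" n]
        by (cases "q = Max A") (auto simp: A_def)
      then show ?thesis
        using False m_o by simp
    qed (use q m_o in simp)
  qed
  have "q \<in> {m_o n r m + 1..n} \<longleftrightarrow> q \<in> {1..n} \<and> beta n m q < int r" for q
    using mem[of q] by auto
  then show ?thesis
    by blast
qed

text \<open>
  Both sides list the same distinct numbers in descending order: the relocated sequence is already sorted.
\<close>

lemma Delta_eq:
  assumes c: "decreasing_upto n (beta n m)" and q: "q \<in> {1..n}" and p: "p \<in> {1..n}"
    and v: "reflected_entry n r m q = of_int v + 1 / 2"
    and dec: "decreasing_upto n (relocate (beta n m) q p v)"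
  shows "Delta n r m q = map (\<lambda>i. of_int (relocate (beta n m) q p v i) + 1 / 2) [1..<Suc n]"
proof -
  define half where "half k = (of_int k + 1 / 2 :: rat)" for k
  have half_mono: "half j < half k \<longleftrightarrow> j < k" for j k
    by (simp add: half_def)
  define b where "b = relocate (beta n m) q p v"
  define xs where "xs = map ((shifted n m)(q := reflected_entry n r m q)) [1..<Suc n]"
  define ys where "ys = map (\<lambda>i. half (b i)) [1..<Suc n]"
  have ys: "sorted_wrt (<) (rev ys)"
    using sorted_map_decreasing[OF dec]
    by (simp add: ys_def b_def rev_map sorted_wrt_map half_mono del: upt_Suc)
  have xs: "xs = map half (map ((beta n m)(q := v)) [1..<Suc n])"
    by (simp add: xs_def shifted_eq v half_def del: upt_Suc)
  have new: "v \<notin> beta n m ` ({1..n} - {q})"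
    by (rule relocate_decreasing_imp_new[OF q p dec])
  have "inj_on ((beta n m)(q := v)) {1..n}"
  proof (rule inj_onI)
    fix i j
    assume ij: "i \<in> {1..n}" "j \<in> {1..n}" "((beta n m)(q := v)) i = ((beta n m)(q := v)) j"
    have "v \<noteq> beta n m k" if "k \<in> {1..n}" "k \<noteq> q" for k
      using new that by blast
    then show "i = j"
      using ij decreasing_upto_inj[OF c ij(1,2)] by (cases "i = q"; cases "j = q") (simp_all, metis+)
  qed
  moreover have "inj half"
    by (auto simp: half_def inj_def)
  ultimately have "distinct xs"
    unfolding xs distinct_map atLeastLessThanSuc_atLeastAtMost set_map set_upt
    by (simp add: inj_on_subset[OF _ subset_UNIV] del: upt_Suc)
  have "set xs = half ` ((beta n m)(q := v)) ` {1..n}"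
    by (simp only: xs set_map set_upt atLeastLessThanSuc_atLeastAtMost)
  also have "((beta n m)(q := v)) ` {1..n} = insert v (beta n m ` ({1..n} - {q}))"
    unfolding relocate_self[symmetric] by (rule image_relocate[OF q q])
  also have "\<dots> = b ` {1..n}"
    by (simp only: b_def image_relocate[OF q p])
  also have "half ` b ` {1..n} = set ys"
    by (simp add: ys_def atLeastLessThanSuc_atLeastAtMost image_image del: upt_Suc)
  finally have "set xs = set ys" .
  then have "sort xs = rev ys"
    using ys \<open>distinct xs\<close> by (intro strict_sorted_equal) (auto simp: strict_sorted_iff)
  then show ?thesis
    by (simp only: Delta_def xs_def[symmetric] rev_rev_ident ys_def b_def half_def)
qed

text \<open>
  Reflection turns the negative entry \<open>c\<^sub>q - r\<close> into \<open>v = r - c\<^sub>q - 1\<close>, that is, \<open>v + 1/2\<close> is the reflected entry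
  of the list \<open>Delta\<close>. Sorting gives the sign \<open>(-1)\<^sup>p\<^sup>+\<^sup>q\<close>, and the reflection one more factor \<open>-1\<close>.
\<close>

lemma alternant_reflected_term:
  fixes y :: "nat \<Rightarrow> 'k::field"
  assumes m: "is_partition m" and q: "q \<in> {1..n}" and small: "beta n m q < int r"
    and new: "int r - beta n m q - 1 \<notin> beta n m ` ({1..n} - {q})"
  shows "alternant y n ((beta n m)(q := beta n m q - int r)) =
      (-1) powi (int (p_index n r m q) - int q + 1) * alternant y n (beta n (mu_o n r m q))"
    and "length_at_most n (mu_o n r m q)"
proof -
  define v where "v = int r - beta n m q - 1"
  define b where "b p = relocate (beta n m) q p v" for p
  have c: "decreasing_upto n (beta n m)"
    by (rule decreasing_beta[OF m])
  obtain p where p: "p \<in> {1..n}" and dec: "decreasing_upto n (b p)"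
    using relocate_exists[OF c q] new unfolding b_def v_def by blast
  have entry: "reflected_entry n r m q = of_int v + 1 / 2"
    by (simp add: reflected_entry_def shifted_eq v_def)
  have Delta: "Delta n r m q ! (i - 1) = of_int (b p i) + 1 / 2" if "i \<in> {1..n}" for i
    using that Delta_eq[OF c q p entry dec[unfolded b_def]]
    by (auto simp: b_def nth_append simp del: upt_Suc)
  have "b p ` {1..n} \<subseteq> {0..}"
    unfolding b_def image_relocate[OF q p] using small by (auto simp: v_def beta_def)
  then obtain l where l: "is_partition l" "length_at_most n l"
      and beta_l: "\<And>i. i \<in> {1..n} \<Longrightarrow> beta n l i = b p i"
    using partition_of_beta[OF dec] by (metis atLeast_iff image_subset_iff)
  have mu_o: "mu_o n r m q = l"
  proof
    fix i
    show "mu_o n r m q i = l i"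
    proof (cases "i \<in> {1..n}")
      case True
      have "Delta n r m q ! (i - 1) - delta n i = of_int (int (l i))"
        using Delta[OF True] beta_l[OF True, symmetric] by (simp add: beta_def delta_def)
      then show ?thesis
        using True by (simp add: mu_o_def)
    next
      case False
      then show ?thesis
        using l by (cases "i = 0") (auto simp: mu_o_def is_partition_def length_at_most_def)
    qed
  qed
  have p_index: "p_index n r m q = p"
    unfolding p_index_def
  proof (rule the_equality)
    show "p \<in> {1..n} \<and> Delta n r m q ! (p - 1) = reflected_entry n r m q"
      using p Delta[OF p] by (simp add: entry b_def relocate_def)
    fix p'
    assume p': "p' \<in> {1..n} \<and> Delta n r m q ! (p' - 1) = reflected_entry n r m q"
    then have "b p p' = b p p"
      using Delta[of p'] by (simp add: entry b_def relocate_def)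
    then show "p' = p"
      using decreasing_upto_inj[OF dec] p p' by blast
  qed
  have "alternant y n ((beta n m)(q := beta n m q - int r)) = - alternant y n ((beta n m)(q := v))"
    by (subst alternant_reflect[OF q]) (simp add: v_def)
  also have "\<dots> = - ((-1) ^ (p + q) * alternant y n (b p))"
    unfolding b_def by (simp only: alternant_relocate[OF q p])
  also have "alternant y n (b p) = alternant y n (beta n l)"
    by (rule alternant_cong) (simp add: beta_l)
  also have "- ((-1) ^ (p + q) * alternant y n (beta n l)) =
      (-1) powi (int p - int q + 1) * alternant y n (beta n l)"
    by (auto simp: minus_one_power_iff power_int_minus_left)
  finally show "alternant y n ((beta n m)(q := beta n m q - int r)) =
      (-1) powi (int (p_index n r m q) - int q + 1) * alternant y n (beta n (mu_o n r m q))"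
    by (simp only: mu_o p_index)
  show "length_at_most n (mu_o n r m q)"
    using l mu_o by simp
qed

lemma reflected_coincidence_iff:
  "(\<exists>j\<in>{1..n} - {q}. reflected_entry n r m q = shifted n m j) \<longleftrightarrow>
    int r - beta n m q - 1 \<in> beta n m ` ({1..n} - {q})"
proof -
  have "reflected_entry n r m q = shifted n m j \<longleftrightarrow> int r - beta n m q - 1 = beta n m j" for j
  proof -
    have "reflected_entry n r m q - shifted n m j = of_int (int r - beta n m q - 1 - beta n m j)"
      by (simp add: reflected_entry_def shifted_eq)
    then show ?thesis
      by (metis eq_iff_diff_eq_0 of_int_eq_0_iff)
  qed
  then show ?thesis
    by auto
qed

text \<open>
  If \<open>r - c\<^sub>q - 1\<close> is also another entry, the alternant on the left vanishes, in accordance with the convention for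
  \<open>so_mu_o\<close>.
\<close>

lemma reflected_term:
  assumes m: "is_partition m" and q: "q \<in> {1..n}" and small: "beta n m q < int r"
  shows "alternant sqrt_x n ((beta n m)(q := beta n m q - int r)) / so_det n (\<lambda>_. 0) =
    ((-1) powi (int (p_index n r m q) - int q + 1) * so_mu_o n r m q :: 'a::idom ratfun)"
proof (cases "int r - beta n m q - 1 \<in> beta n m ` ({1..n} - {q})")
  case True
  then obtain j where j: "j \<in> {1..n}" "j \<noteq> q" "int r - beta n m q - 1 = beta n m j"
    by blast
  have "alternant sqrt_x n ((beta n m)(q := beta n m q - int r)) =
      - (alternant sqrt_x n ((beta n m)(q := beta n m j)) :: 'a ratfun)"
    by (subst alternant_reflect[OF q]) (simp add: j(3)[symmetric])
  also have "alternant sqrt_x n ((beta n m)(q := beta n m j)) = (0 :: 'a ratfun)"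
    using j q by (intro alternant_repeated[of q n j]) auto
  finally have "alternant sqrt_x n ((beta n m)(q := beta n m q - int r)) = (0 :: 'a ratfun)"
    by (simp only: minus_zero)
  then show ?thesis
    using True unfolding so_mu_o_def reflected_coincidence_iff by (simp only: if_True div_0 mult_zero_right)
next
  case False
  then show ?thesis
    using alternant_reflected_term(1)[OF assms False, of "sqrt_x :: nat \<Rightarrow> 'a ratfun"]
      alternant_reflected_term(2)[OF assms False]
    unfolding so_mu_o_def reflected_coincidence_iff by (simp only: if_False so_eq times_divide_eq_right)
qed

section \<open>The product of a power sum and a character\<close>

theorem theorem3p7:
  fixes n r :: nat and \<mu> :: "nat \<Rightarrow> nat"
  assumes "n \<ge> 1" and "r \<ge> 1"
    and "is_partition \<mu>" and "length_at_most n \<mu>"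
  shows "(pbar n r * so n \<mu> :: 'a::idom ratfun) =
      (\<Sum>\<eta> | is_partition \<eta> \<and> border_strip r \<eta> \<mu>. (-1) ^ height \<eta> \<mu> * so n \<eta>)
    + (\<Sum>\<xi> | is_partition \<xi> \<and> border_strip r \<mu> \<xi>. (-1) ^ height \<mu> \<xi> * so n \<xi>)
    + (\<Sum>q = m_o n r \<mu> + 1..n.
         (-1) powi (int (p_index n r \<mu> q) - int q + 1) * so_mu_o n r \<mu> q)"
proof -
  define c where "c = beta n \<mu>"
  define alt :: "(nat \<Rightarrow> int) \<Rightarrow> 'a ratfun" where "alt = alternant sqrt_x n"
  define D :: "'a ratfun" where "D = so_det n (\<lambda>_. 0)"
  have so: "so n l = alt (beta n l) / D" if "length_at_most n l" for l
    using that by (simp add: so_eq alt_def D_def)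
  \<comment> \<open>Partitions with more than \<open>n\<close> rows contribute nothing.\<close>
  have "(\<Sum>\<eta> | is_partition \<eta> \<and> border_strip r \<eta> \<mu>. (-1) ^ height \<eta> \<mu> * so n \<eta>) =
      (\<Sum>\<eta> | is_partition \<eta> \<and> border_strip r \<eta> \<mu> \<and> length_at_most n \<eta>. (-1) ^ height \<eta> \<mu> * so n \<eta>)"
    using finite_border_strips[OF assms(4,2)]
    by (intro sum.mono_neutral_right) (auto simp: so_def)
  also have "\<dots> = (\<Sum>\<eta> | is_partition \<eta> \<and> border_strip r \<eta> \<mu> \<and> length_at_most n \<eta>.
      (-1) ^ height \<eta> \<mu> * alt (beta n \<eta>)) / D"
    unfolding sum_divide_distrib by (intro sum.cong) (auto simp: so)
  also have "\<dots> = (\<Sum>q=1..n. alt (c(q := c q + int r))) / D"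
    unfolding c_def alt_def sum_alternant_add_strips[OF assms(3,4,2)] ..
  finally have add: "(\<Sum>\<eta> | is_partition \<eta> \<and> border_strip r \<eta> \<mu>. (-1) ^ height \<eta> \<mu> * so n \<eta>) =
      (\<Sum>q=1..n. alt (c(q := c q + int r))) / D" .
  have "(\<Sum>\<xi> | is_partition \<xi> \<and> border_strip r \<mu> \<xi>. (-1) ^ height \<mu> \<xi> * so n \<xi>) =
      (\<Sum>\<xi> | is_partition \<xi> \<and> border_strip r \<mu> \<xi>. (-1) ^ height \<mu> \<xi> * alt (beta n \<xi>)) / D"
    unfolding sum_divide_distrib
    by (intro sum.cong) (auto simp: so border_strip_length_at_most[OF _ assms(4)])
  also have "\<dots> = (\<Sum>q | q \<in> {1..n} \<and> int r \<le> c q. alt (c(q := c q - int r))) / D"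
    unfolding c_def alt_def sum_alternant_remove_strips[OF assms(3,4,2)] ..
  finally have remove: "(\<Sum>\<xi> | is_partition \<xi> \<and> border_strip r \<mu> \<xi>. (-1) ^ height \<mu> \<xi> * so n \<xi>) =
      (\<Sum>q | q \<in> {1..n} \<and> int r \<le> c q. alt (c(q := c q - int r))) / D" .
  have reflect: "(\<Sum>q = m_o n r \<mu> + 1..n.
         (-1) powi (int (p_index n r \<mu> q) - int q + 1) * so_mu_o n r \<mu> q) =
      (\<Sum>q | q \<in> {1..n} \<and> c q < int r. alt (c(q := c q - int r))) / D"
    unfolding interval_m_o[OF assms(3)] sum_divide_distrib
    by (intro sum.cong) (auto simp: c_def alt_def D_def reflected_term[OF assms(3)])
  \<comment> \<open>The lowered entries that stay nonnegative give the second sum, the others the third.\<close>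
  have "(\<Sum>q=1..n. alt (c(q := c q - int r))) =
      (\<Sum>q \<in> {q. q \<in> {1..n} \<and> int r \<le> c q} \<union> {q. q \<in> {1..n} \<and> c q < int r}. alt (c(q := c q - int r)))"
    by (intro sum.cong) auto
  also have "\<dots> = (\<Sum>q | q \<in> {1..n} \<and> int r \<le> c q. alt (c(q := c q - int r))) +
      (\<Sum>q | q \<in> {1..n} \<and> c q < int r. alt (c(q := c q - int r)))"
    by (rule sum.union_disjoint) auto
  finally have split: "(\<Sum>q=1..n. alt (c(q := c q - int r))) = \<dots>" .
  have "pbar n r * alt c = (\<Sum>q=1..n. alt (c(q := c q + int r)) + alt (c(q := c q - int r)))"
    using power_sum_times_alternant[of "sqrt_x :: nat \<Rightarrow> 'a ratfun" r n c, OF sqrt_x_nonzero]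
    by (simp add: pbar_def indet_def alt_def)
  then have "pbar n r * so n \<mu> = (\<Sum>q=1..n. alt (c(q := c q + int r))) / D
      + (\<Sum>q | q \<in> {1..n} \<and> int r \<le> c q. alt (c(q := c q - int r))) / D
      + (\<Sum>q | q \<in> {1..n} \<and> c q < int r. alt (c(q := c q - int r))) / D"
    unfolding so[OF assms(4)] c_def[symmetric] times_divide_eq_right
    by (simp only: sum.distrib split add_divide_distrib add.assoc)
  then show ?thesis
    unfolding add remove reflect .
qed

end
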